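(* There is a constant $c>0$ such that for every $n\ge1$ and every 3-presentation $\langle S\mid R\rangle\cong\mathbb{Z}^n$, we have $|S|\ge c\,n^{3/2}$.
   Context: A 3-presentation of a group $G$ is a group presentation $\langle S\mid R\rangle\cong G$ (with $S,R$ finite) in which each relation in $R$ is either the empty word, or $g^a$, or $g^ah^b$, or $g^ah^bi^c$, where $g,h,i\in S$ (not necessarily distinct) and $a,b,c\in\mathbb{Z}$. *)

theory Defs
  imports Complex_Main "HOL-Algebra.Group"
begin

(* Letters of the free group on generators (labelled by naturals):
   (g, True) = g, (g, False) = g^-1. *)
type_synonym letter = "nat \<times> bool"

(* A relation in "exponent form": list of (generator, exponent) pairs,
   representing g1^a1 g2^a2 ... *)
type_synonym expword = "(nat \<times> int) list"

definition power_word :: "nat \<Rightarrow> int \<Rightarrow> letter list" where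
  "power_word g a = replicate (nat \<bar>a\<bar>) (g, a \<ge> 0)"

definition rel_word :: "expword \<Rightarrow> letter list" where
  "rel_word r = concat (map (\<lambda>(g, a). power_word g a) r)"

definition three_rel :: "nat set \<Rightarrow> expword \<Rightarrow> bool" where
  "three_rel S r \<longleftrightarrow> length r \<le> 3 \<and> fst ` set r \<subseteq> S"

(* The congruence on words over S generated by free cancellation and
   deletion of relators; its class of the empty word is the normal closure. *)
inductive pres_eq :: "nat set \<Rightarrow> letter list set \<Rightarrow> letter list \<Rightarrow> letter list \<Rightarrow> bool"
  for S :: "nat set" and RW :: "letter list set" where
  pe_refl: "w \<in> lists (S \<times> UNIV) \<Longrightarrow> pres_eq S RW w w"
| pe_sym: "pres_eq S RW u v \<Longrightarrow> pres_eq S RW v u"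
| pe_trans: "pres_eq S RW u v \<Longrightarrow> pres_eq S RW v w \<Longrightarrow> pres_eq S RW u w"
| pe_cancel: "x \<in> lists (S \<times> UNIV) \<Longrightarrow> y \<in> lists (S \<times> UNIV) \<Longrightarrow> s \<in> S \<Longrightarrow>
     pres_eq S RW (x @ [(s, b), (s, \<not> b)] @ y) (x @ y)"
| pe_rel: "x \<in> lists (S \<times> UNIV) \<Longrightarrow> y \<in> lists (S \<times> UNIV) \<Longrightarrow> r \<in> RW \<Longrightarrow>
     r \<in> lists (S \<times> UNIV) \<Longrightarrow> pres_eq S RW (x @ r @ y) (x @ y)"

definition pres_group :: "nat set \<Rightarrow> letter list set \<Rightarrow> letter list set monoid" where
  "pres_group S RW =
     \<lparr> carrier = {{v. pres_eq S RW w v} | w. w \<in> lists (S \<times> UNIV)},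
       mult = (\<lambda>A B. {v. \<exists>a\<in>A. \<exists>b\<in>B. pres_eq S RW (a @ b) v}),
       one = {v. pres_eq S RW [] v} \<rparr>"

definition Zn_group :: "nat \<Rightarrow> (nat \<Rightarrow> int) monoid" where
  "Zn_group n =
     \<lparr> carrier = {v. \<forall>i\<ge>n. v i = 0},
       mult = (\<lambda>u v i. u i + v i),
       one = (\<lambda>_. 0) \<rparr>"

end

theory Submission
  imports Defs
begin

text \<open>Send the generators to vectors \<open>x\<^sub>g\<close> of \<open>\<int>\<^sup>n\<close>. If an alternating form \<open>\<omega>\<close> vanishes on the span of
  every linearly dependent triple of generators, then the lifts \<open>(x\<^sub>g, 0)\<close> to the Heisenberg group of \<open>\<omega>\<close>
  still satisfy all relations, hence commute, and \<open>\<omega> = 0\<close>. By duality the planes of the dependent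
  triples span the exterior square, so there are at least \<open>n(n-1)/2\<close> dependent triples, any two of
  which share at most one generator. Some generator therefore lies in at least \<open>3n(n-1)/(2|S|)\<close> of
  them; passing to the quotient by its vector makes that many generators redundant and lowers the
  dimension by one. Induction on \<open>n\<close> gives \<open>n\<^sup>3 \<le> 2|S|\<^sup>2 + n\<close>.\<close>

section \<open>Linear systems and counting of pairs\<close>

text \<open>Gaussian elimination: an equation with a nonzero coefficient at \<open>e0\<close> is
  solved for that unknown and substituted into the others, which costs one equation and one unknown.
  It later supplies a nonzero alternating form subject to fewer conditions than it has
  coordinates.\<close>

lemma homogeneous_system_nontrivial:
  fixes M :: "'l \<Rightarrow> 'e \<Rightarrow> 'a::field"
  assumes "finite L" "finite E" "card L < card E"
  shows "\<exists>a. (\<exists>e\<in>E. a e \<noteq> 0) \<and> (\<forall>l\<in>L. (\<Sum>e\<in>E. M l e * a e) = 0)"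
  using assms
proof (induction L arbitrary: E M rule: finite_induct)
  case empty
  then have "E \<noteq> {}" by auto
  then show ?case by (intro exI[of _ "\<lambda>_. 1"]) auto
next
  case (insert l L)
  show ?case
  proof (cases "\<forall>e\<in>E. M l e = 0")
    case True
    have "card L < card E" using insert by simp
    from insert.IH[OF insert.prems(1) this, of M] True show ?thesis by auto
  next
    case False
    then obtain e0 where e0: "e0 \<in> E" "M l e0 \<noteq> 0" by blast
    define F where "F = E - {e0}"
    have F: "finite F" "e0 \<notin> F" "E = insert e0 F" "card L < card F"
      using insert e0 by (auto simp: F_def card_Diff_singleton)
    obtain a where a: "\<exists>e\<in>F. a e \<noteq> 0"
      "\<forall>k\<in>L. (\<Sum>e\<in>F. (M k e - M k e0 * M l e / M l e0) * a e) = 0"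
      using insert.IH[OF F(1,4), of "\<lambda>k e. M k e - M k e0 * M l e / M l e0"] by blast
    define r where "r = (\<Sum>e\<in>F. M l e * a e)"
    \<comment> \<open>The value at \<open>e0\<close> is the one that equation \<open>l\<close>
      forces.\<close>
    define a' where "a' = a(e0 := - r / M l e0)"
    have sum': "(\<Sum>e\<in>E. M k e * a' e) = (\<Sum>e\<in>F. M k e * a e) - M k e0 * r / M l e0" for k
    proof -
      have "(\<Sum>e\<in>F. M k e * a' e) = (\<Sum>e\<in>F. M k e * a e)"
        using F(2) by (intro sum.cong) (auto simp: a'_def)
      then show ?thesis using F by (simp add: a'_def)
    qed
    have "(\<Sum>e\<in>E. M k e * a' e) = 0" if "k \<in> insert l L" for k
    proof (cases "k = l")
      case True
      then show ?thesis using e0 sum'[of l] by (simp add: r_def)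
    next
      case False
      then have "k \<in> L" using that by simp
      then have "0 = (\<Sum>e\<in>F. (M k e - M k e0 * M l e / M l e0) * a e)" using a by simp
      also have "\<dots> = (\<Sum>e\<in>F. M k e * a e - M k e0 / M l e0 * (M l e * a e))"
        by (intro sum.cong) (auto simp: algebra_simps)
      also have "\<dots> = (\<Sum>e\<in>F. M k e * a e) - M k e0 / M l e0 * r"
        by (simp add: sum_subtractf r_def sum_distrib_left)
      finally show ?thesis by (simp add: sum')
    qed
    moreover have "\<exists>e\<in>E. a' e \<noteq> 0" using a(1) F by (auto simp: a'_def)
    ultimately show ?thesis by blast
  qed
qed

lemma card_pairs_less:
  fixes I :: "'i::linorder set"
  assumes "finite I"
  shows "2 * card {(i, j). i \<in> I \<and> j \<in> I \<and> i < j} = card I * (card I - 1)"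
proof -
  let ?E = "{(i, j). i \<in> I \<and> j \<in> I \<and> i < j}"
  let ?E' = "{(i, j). i \<in> I \<and> j \<in> I \<and> j < i}"
  let ?D = "(\<lambda>i. (i, i)) ` I"
  have fin: "finite ?E" "finite ?E'"
    by (rule finite_subset[of _ "I \<times> I"]; use assms in auto)+
  have "bij_betw prod.swap ?E ?E'"
    by (intro bij_betwI[where g = prod.swap]) auto
  then have eq: "card ?E' = card ?E" by (simp add: bij_betw_same_card)
  have D: "card ?D = card I" by (intro card_image) (auto simp: inj_on_def)
  have "I \<times> I = (?E \<union> ?E') \<union> ?D" by auto
  then have "card I * card I = card ((?E \<union> ?E') \<union> ?D)" by (simp flip: card_cartesian_product)
  also have "\<dots> = card (?E \<union> ?E') + card ?D"
    using fin assms by (intro card_Un_disjoint) auto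
  also have "card (?E \<union> ?E') = card ?E + card ?E'"
    using fin by (intro card_Un_disjoint) auto
  finally show ?thesis using eq D by (simp add: algebra_simps diff_mult_distrib2)
qed

section \<open>Alternating forms and dependent triples\<close>

text \<open>Linearity is asked in the first argument only: antisymmetry carries it to the second
  and, over the reals, gives vanishing on the diagonal.\<close>

definition alternating :: "(('i \<Rightarrow> real) \<Rightarrow> ('i \<Rightarrow> real) \<Rightarrow> real) \<Rightarrow> bool" where
  "alternating \<omega> \<longleftrightarrow>
     (\<forall>a b x y z. \<omega> (\<lambda>k. a * x k + b * y k) z = a * \<omega> x z + b * \<omega> y z) \<and>
     (\<forall>x y. \<omega> x y = - \<omega> y x)"

text \<open>Nonzero coefficients put each vector in the span of the other two, so that the vanishing
  of a form on one pair spreads to the other pairs. Repeated generators and zero vectors are still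
  allowed here.\<close>

definition dependent_triple :: "('s \<Rightarrow> 'i \<Rightarrow> real) \<Rightarrow> 's \<Rightarrow> 's \<Rightarrow> 's \<Rightarrow> bool" where
  "dependent_triple x g h i \<longleftrightarrow>
     (\<exists>a b c. a \<noteq> 0 \<and> b \<noteq> 0 \<and> c \<noteq> 0 \<and> (\<forall>k. a * x g k + b * x h k + c * x i k = 0))"

definition unit_vec :: "'i \<Rightarrow> 'i \<Rightarrow> real" where
  "unit_vec i = (\<lambda>k. if k = i then 1 else 0)"

text \<open>Dual form of: the bivectors of the planes spanned by dependent triples generate the
  exterior square of the space with basis \<open>I\<close>.\<close>
definition triples_span_bivectors :: "'s set \<Rightarrow> ('s \<Rightarrow> 'i \<Rightarrow> real) \<Rightarrow> 'i set \<Rightarrow> bool" where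
  "triples_span_bivectors S x I \<longleftrightarrow>
     (\<forall>\<omega>. alternating \<omega> \<longrightarrow>
        (\<forall>g\<in>S. \<forall>h\<in>S. \<forall>i\<in>S. dependent_triple x g h i \<longrightarrow> \<omega> (x g) (x h) = 0) \<longrightarrow>
        (\<forall>i\<in>I. \<forall>j\<in>I. \<omega> (unit_vec i) (unit_vec j) = 0))"

lemma alternatingD:
  assumes "alternating \<omega>"
  shows "\<omega> (\<lambda>k. a * x k + b * y k) z = a * \<omega> x z + b * \<omega> y z" "\<omega> x y = - \<omega> y x"
  using assms unfolding alternating_def by blast+

lemma alternating_self: "alternating \<omega> \<Longrightarrow> \<omega> x x = 0"
  using alternatingD(2)[of \<omega> x x] by simp

lemma alternating_scale: "alternating \<omega> \<Longrightarrow> \<omega> (\<lambda>k. a * x k) z = a * \<omega> x z"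
  using alternatingD(1)[of \<omega> a x 0 x z] by simp

lemma alternating_scale_right: "alternating \<omega> \<Longrightarrow> \<omega> z (\<lambda>k. a * x k) = a * \<omega> z x"
  using alternating_scale[of \<omega> a x z] alternatingD(2)[of \<omega> z] by simp

lemma alternating_zero: "alternating \<omega> \<Longrightarrow> \<omega> (\<lambda>k. 0) z = 0"
  using alternating_scale[of \<omega> 0 "\<lambda>_. 0" z] by simp

lemma alternating_zero_right: "alternating \<omega> \<Longrightarrow> \<omega> z (\<lambda>k. 0) = 0"
  using alternating_zero[of \<omega> z] alternatingD(2)[of \<omega> z] by simp

lemma alternating_add: "alternating \<omega> \<Longrightarrow> \<omega> (\<lambda>k. x k + y k) z = \<omega> x z + \<omega> y z"
  using alternatingD(1)[of \<omega> 1 x 1 y z] by simp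

lemma alternating_add_right: "alternating \<omega> \<Longrightarrow> \<omega> z (\<lambda>k. x k + y k) = \<omega> z x + \<omega> z y"
  using alternating_add[of \<omega> x y z] alternatingD(2)[of \<omega> z] by simp

lemma alternating_relation:
  assumes "alternating \<omega>" "\<forall>k. a * x k + b * y k + c * z k = 0"
  shows "a * \<omega> x u + b * \<omega> y u + c * \<omega> z u = 0"
proof -
  have "(\<lambda>k. 1 * (a * x k + b * y k) + c * z k) = (\<lambda>k. 0)" using assms(2) by auto
  then have "1 * \<omega> (\<lambda>k. a * x k + b * y k) u + c * \<omega> z u = 0"
    using alternatingD(1)[OF assms(1), of 1 "\<lambda>k. a * x k + b * y k" c z u]
      alternating_zero[OF assms(1), of u] by simp
  then show ?thesis using alternatingD(1)[OF assms(1)] by simp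
qed

lemma dependent_triple_rotate: "dependent_triple x g h i \<Longrightarrow> dependent_triple x h i g"
proof -
  assume "dependent_triple x g h i"
  then obtain a b c where "a \<noteq> 0" "b \<noteq> 0" "c \<noteq> 0" "\<forall>k. a * x g k + b * x h k + c * x i k = 0"
    unfolding dependent_triple_def by blast
  then show ?thesis unfolding dependent_triple_def
    by (intro exI[of _ b] exI[of _ c] exI[of _ a]) (simp add: add.commute add.left_commute)
qed

lemma dependent_triple_swap: "dependent_triple x g h i \<Longrightarrow> dependent_triple x h g i"
proof -
  assume "dependent_triple x g h i"
  then obtain a b c where "a \<noteq> 0" "b \<noteq> 0" "c \<noteq> 0" "\<forall>k. a * x g k + b * x h k + c * x i k = 0"
    unfolding dependent_triple_def by blast
  then show ?thesis unfolding dependent_triple_def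
    by (intro exI[of _ b] exI[of _ a] exI[of _ c]) (simp add: add.commute)
qed

text \<open>Pairing the relation with \<open>x h\<close> or with \<open>x g\<close> kills two of its
  three terms and leaves \<open>c\<close> times the wanted value, up to sign.\<close>

lemma dependent_triple_isotropic:
  assumes "alternating \<omega>" "dependent_triple x g h i" "\<omega> (x g) (x h) = 0"
  shows "\<omega> (x h) (x i) = 0" "\<omega> (x g) (x i) = 0"
proof -
  obtain a b c where abc: "c \<noteq> 0" "\<forall>k. a * x g k + b * x h k + c * x i k = 0"
    using assms(2) unfolding dependent_triple_def by blast
  note rel = alternating_relation[OF assms(1) abc(2)]
  have "\<omega> (x i) (x h) = 0"
    using rel[of "x h"] assms(3) abc(1) alternating_self[OF assms(1)] by simp
  then show "\<omega> (x h) (x i) = 0" using alternatingD(2)[OF assms(1), of "x h" "x i"] by simp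
  have "\<omega> (x h) (x g) = 0" using alternatingD(2)[OF assms(1), of "x h" "x g"] assms(3) by simp
  then have "\<omega> (x i) (x g) = 0"
    using rel[of "x g"] abc(1) alternating_self[OF assms(1)] by simp
  then show "\<omega> (x g) (x i) = 0" using alternatingD(2)[OF assms(1), of "x g" "x i"] by simp
qed

text \<open>Unordered sets, so that triples can be counted. The excluded degenerate triples, with a
  repeated generator or a zero vector, impose no condition: every alternating form vanishes on
  them.\<close>

definition proper_triples :: "'s set \<Rightarrow> ('s \<Rightarrow> 'i \<Rightarrow> real) \<Rightarrow> 's set set" where
  "proper_triples S x =
     {{g, h, i} | g h i. g \<in> S \<and> h \<in> S \<and> i \<in> S \<and> g \<noteq> h \<and> g \<noteq> i \<and> h \<noteq> i \<and>
        dependent_triple x g h i \<and> (\<forall>p\<in>{g, h, i}. x p \<noteq> (\<lambda>_. 0))}"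

lemma proper_triplesD:
  assumes "t \<in> proper_triples S x"
  shows "t \<subseteq> S" "card t = 3" "p \<in> t \<Longrightarrow> x p \<noteq> (\<lambda>_. 0)"
  using assms unfolding proper_triples_def by auto

text \<open>Rotation and swap generate all permutations of a triple, so any two of its points can be
  taken as the first two.\<close>

lemma proper_triples_rename:
  assumes "t \<in> proper_triples S x" "p \<in> t" "q \<in> t" "p \<noteq> q"
  obtains r where "t = {p, q, r}" "r \<noteq> p" "r \<noteq> q" "dependent_triple x p q r"
proof -
  obtain g h i where t: "t = {g, h, i}" "g \<noteq> h" "g \<noteq> i" "h \<noteq> i" and d: "dependent_triple x g h i"
    using assms(1) unfolding proper_triples_def by blast
  note d1 = dependent_triple_rotate[OF d]
  note d2 = dependent_triple_rotate[OF d1]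
  note ds = d d1 d2 dependent_triple_swap[OF d] dependent_triple_swap[OF d1] dependent_triple_swap[OF d2]
  consider "p = g" "q = h" | "p = g" "q = i" | "p = h" "q = g" | "p = h" "q = i"
    | "p = i" "q = g" | "p = i" "q = h" using assms t by auto
  then show thesis
  proof cases
    case 1 then show ?thesis using that[of i] t ds by auto
  next
    case 2 then show ?thesis using that[of h] t ds by auto
  next
    case 3 then show ?thesis using that[of i] t ds by auto
  next
    case 4 then show ?thesis using that[of g] t ds by auto
  next
    case 5 then show ?thesis using that[of h] t ds by auto
  next
    case 6 then show ?thesis using that[of g] t ds by auto
  qed
qed

text \<open>A triple thus imposes a single scalar condition on \<open>\<omega>\<close>, which can be
  tested on any two of its points.\<close>

lemma proper_triples_isotropic:
  assumes "alternating \<omega>" "t \<in> proper_triples S x" "p \<in> t" "q \<in> t" "p \<noteq> q" "\<omega> (x p) (x q) = 0"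
    and "p' \<in> t" "q' \<in> t"
  shows "\<omega> (x p') (x q') = 0"
proof -
  obtain r where r: "t = {p, q, r}" "dependent_triple x p q r"
    using proper_triples_rename[OF assms(2-5)] by metis
  note * = dependent_triple_isotropic[where \<omega> = \<omega> and x = x, OF assms(1) r(2) assms(6)]
  have sym: "\<omega> u v = 0 \<Longrightarrow> \<omega> v u = 0" for u v using alternatingD(2)[OF assms(1), of v u] by simp
  show ?thesis using assms(6,7,8) r(1) * sym alternating_self[OF assms(1)] by auto
qed

section \<open>Packings of triples, quotients and the cubic bound\<close>

text \<open>For sets of size three this is a partial Steiner triple system.\<close>

definition triple_packing :: "'s set set \<Rightarrow> bool" where
  "triple_packing T \<longleftrightarrow> (\<forall>t\<in>T. \<forall>u\<in>T. \<forall>p\<in>t \<inter> u. \<forall>q\<in>t \<inter> u. p \<noteq> q \<longrightarrow> t = u)"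

text \<open>Each triple imposes a single linear condition on an alternating form, and triples sharing
  two points impose the same one; so a maximal packing imposes all conditions.\<close>
lemma large_triple_packing:
  fixes x :: "'s \<Rightarrow> 'i::linorder \<Rightarrow> real"
  assumes "finite S" "finite I" "triples_span_bivectors S x I"
  obtains T where "T \<subseteq> proper_triples S x" "triple_packing T" "card I * (card I - 1) \<le> 2 * card T"
proof -
  define D where "D = proper_triples S x"
  have finD: "finite D"
    by (rule finite_subset[of _ "Pow S"]) (use assms(1) proper_triplesD(1)[of _ S x] in \<open>auto simp: D_def\<close>)
  define F where "F = {T. T \<subseteq> D \<and> triple_packing T}"
  have "finite F" using finD by (auto simp: F_def)
  moreover have "{} \<in> F" by (auto simp: F_def triple_packing_def)
  ultimately obtain T where T: "T \<in> F" "\<And>U. U \<in> F \<Longrightarrow> T \<subseteq> U \<Longrightarrow> T = U"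
    using finite_has_maximal[of F] by blast
  have TD: "T \<subseteq> D" and pT: "triple_packing T" using T(1) by (auto simp: F_def)
  \<comment> \<open>A triple meeting every member of \<open>T\<close> in at most one point could be
    added to \<open>T\<close>, against maximality.\<close>
  have cover: "\<exists>t\<in>T. \<exists>p\<in>t \<inter> u. \<exists>q\<in>t \<inter> u. p \<noteq> q" if u: "u \<in> D" for u
  proof (rule ccontr)
    assume neg: "\<not> ?thesis"
    have cross: "p = q" if "t \<in> T" "p \<in> t" "p \<in> u" "q \<in> t" "q \<in> u" for t p q
      using neg that by blast
    have "triple_packing (insert u T)"
      using pT unfolding triple_packing_def
      by (intro ballI impI) (metis IntE cross insertE IntI)
    then have "insert u T \<in> F" using u TD by (simp add: F_def)
    then have "u \<in> T" using T(2)[of "insert u T"] by auto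
    moreover have "\<exists>p\<in>u. \<exists>q\<in>u. p \<noteq> q"
      using u unfolding D_def proper_triples_def by blast
    ultimately show False using neg by blast
  qed
  define E where "E = {(i, j). i \<in> I \<and> j \<in> I \<and> i < j}"
  have finE: "finite E"
    by (rule finite_subset[of _ "I \<times> I"]) (use assms(2) in \<open>auto simp: E_def\<close>)
  have "card E \<le> card T"
  proof (rule ccontr)
    assume "\<not> ?thesis"
    then have less: "card T < card E" by simp
    have "\<forall>t\<in>T. \<exists>p q. p \<in> t \<and> q \<in> t \<and> p \<noteq> q"
      using TD unfolding D_def proper_triples_def by blast
    then obtain P Q where PQ: "\<And>t. t \<in> T \<Longrightarrow> P t \<in> t \<and> Q t \<in> t \<and> P t \<noteq> Q t" by metis
    \<comment> \<open>The Pluecker coordinates (2 by 2 minors) of the bivector spanned by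
      \<open>u\<close> and \<open>v\<close>; an alternating form on the coordinates in
      \<open>I\<close> is a linear functional of them.\<close>
    define B where "B = (\<lambda>(u :: 'i \<Rightarrow> real) v (i, j). u i * v j - u j * v i)"
    obtain a where a: "\<exists>e\<in>E. a e \<noteq> 0"
      "\<forall>t\<in>T. (\<Sum>e\<in>E. B (x (P t)) (x (Q t)) e * a e) = 0"
      using homogeneous_system_nontrivial[OF finite_subset[OF TD finD] finE less,
        of "\<lambda>t. B (x (P t)) (x (Q t))"] by blast
    define \<omega> where "\<omega> = (\<lambda>u v. \<Sum>e\<in>E. B u v e * a e)"
    have alt: "alternating \<omega>"
      unfolding alternating_def
    proof (intro conjI allI)
      fix c d :: real and u v w :: "'i \<Rightarrow> real"
      show "\<omega> (\<lambda>k. c * u k + d * v k) w = c * \<omega> u w + d * \<omega> v w"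
        unfolding \<omega>_def sum_distrib_left sum.distrib[symmetric]
        by (intro sum.cong) (auto simp: B_def algebra_simps)
      show "\<omega> u v = - \<omega> v u"
        unfolding \<omega>_def sum_negf[symmetric]
        by (intro sum.cong) (auto simp: B_def algebra_simps)
    qed
    have "\<omega> (x g) (x h) = 0"
      if ghi: "g \<in> S" "h \<in> S" "i \<in> S" "dependent_triple x g h i" for g h i
    proof (cases "{g, h, i} \<in> D")
      case True
      then obtain t p q where t: "t \<in> T" "p \<in> t" "q \<in> t" "p \<in> {g,h,i}" "q \<in> {g,h,i}" "p \<noteq> q"
        using cover by (metis IntE)
      have "t \<in> proper_triples S x" using t TD D_def by auto
      from proper_triples_isotropic[where \<omega> = \<omega> and x = x, OF alt this _ _ _ _ t(2,3), of "P t" "Q t"]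
      have "\<omega> (x p) (x q) = 0" using PQ[OF t(1)] a(2) t(1) by (simp add: \<omega>_def)
      from proper_triples_isotropic[where \<omega> = \<omega> and x = x, OF alt True[unfolded D_def] t(4-6) this, of g h]
      show ?thesis by simp
    next
      case False
      \<comment> \<open>In a degenerate triple the form vanishes on some pair, and dependence
        carries this over to the pair \<open>g\<close>, \<open>h\<close>.\<close>
      then have "g = h \<or> g = i \<or> h = i \<or> x g = (\<lambda>_. 0) \<or> x h = (\<lambda>_. 0) \<or> x i = (\<lambda>_. 0)"
        using ghi unfolding D_def proper_triples_def by blast
      then have "\<omega> (x g) (x h) = 0 \<or> \<omega> (x h) (x i) = 0 \<or> \<omega> (x i) (x g) = 0"
        by (elim disjE) (simp_all add: alternating_self[OF alt] alternating_zero[OF alt]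
            alternating_zero_right[OF alt])
      moreover note d1 = dependent_triple_rotate[OF ghi(4)]
      note dependent_triple_isotropic(2)[where \<omega> = \<omega> and x = x, OF alt d1]
        dependent_triple_isotropic(1)[where \<omega> = \<omega> and x = x, OF alt dependent_triple_rotate[OF d1]]
      moreover have "\<omega> (x g) (x h) = - \<omega> (x h) (x g)" by (rule alternatingD(2)[OF alt])
      ultimately show ?thesis by auto
    qed
    then have z: "\<forall>i\<in>I. \<forall>j\<in>I. \<omega> (unit_vec i) (unit_vec j) = 0"
      using assms(3) alt unfolding triples_span_bivectors_def by blast
    have "a e = 0" if e: "e \<in> E" for e
    proof -
      obtain i j where ij: "e = (i, j)" "i \<in> I" "j \<in> I" "i < j" using e by (auto simp: E_def)
      \<comment> \<open>Pairs in \<open>E\<close> are increasing, so only the summand at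
        \<open>(i, j)\<close> survives: the coefficients \<open>a\<close> are values of
        \<open>\<omega>\<close> on unit vectors and must all vanish.\<close>
      have "\<omega> (unit_vec i) (unit_vec j) = (\<Sum>f\<in>E. if f = e then a f else 0)"
        unfolding \<omega>_def
        by (intro sum.cong) (use ij in \<open>auto simp: B_def unit_vec_def E_def split: if_splits\<close>)
      also have "\<dots> = a e" using e finE by simp
      finally show ?thesis using z ij by simp
    qed
    then show False using a(1) by blast
  qed
  then have "card I * (card I - 1) \<le> 2 * card T"
    using card_pairs_less[OF assms(2)] unfolding E_def by linarith
  then show thesis using that TD pT D_def by blast
qed

text \<open>Quotient by the vector \<open>x v\<close>: the points of a triple through \<open>v\<close> other than \<open>v\<close> become
  parallel, so one of the two can be dropped.\<close>
lemma quotient_triples_span_bivectors: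
  fixes x :: "'s \<Rightarrow> 'i \<Rightarrow> real"
  assumes fin: "finite S" and span: "triples_span_bivectors S x I"
    and supp: "\<And>s k. s \<in> S \<Longrightarrow> k \<notin> I \<Longrightarrow> x s k = 0"
    and T: "T \<subseteq> proper_triples S x" "triple_packing T"
    and v: "v \<in> S" "x v \<noteq> (\<lambda>_. 0)"
  obtains S' y j where "j \<in> I" "S' \<subseteq> S" "card S' + 1 + card {t \<in> T. v \<in> t} = card S"
    "triples_span_bivectors S' y (I - {j})" "\<And>s k. s \<in> S' \<Longrightarrow> k \<notin> I - {j} \<Longrightarrow> y s k = (0::real)"
proof -
  obtain j where j: "x v j \<noteq> 0" "j \<in> I" using v supp[OF v(1)] unfolding fun_eq_iff by blast
  \<comment> \<open>The quotient by \<open>x v\<close> is realised as the projection along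
    \<open>x v\<close> onto the hyperplane where coordinate \<open>j\<close> is zero.\<close>
  define \<pi> where "\<pi> = (\<lambda>(u :: 'i \<Rightarrow> real) k. u k - u j / x v j * x v k)"
  define y where "y = (\<lambda>s. \<pi> (x s))"
  have lin: "\<pi> (\<lambda>k. a * u k + b * w k) = (\<lambda>k. a * \<pi> u k + b * \<pi> w k)" for a b u w
    using j by (auto simp: \<pi>_def field_simps)
  have yv: "y v = (\<lambda>_. 0)" using j by (auto simp: y_def \<pi>_def)
  have y_rel: "a * y g k + b * y h k + c * y i k = 0"
    if "\<forall>k. a * x g k + b * x h k + c * x i k = 0" for a b c g h i k
  proof -
    have "a * y g k + b * y h k + c * y i k = (a * x g k + b * x h k + c * x i k)
        - (a * x g j + b * x h j + c * x i j) / x v j * x v k"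
      by (simp add: y_def \<pi>_def add_divide_distrib algebra_simps)
    then show ?thesis using that by simp
  qed
  define Tv where "Tv = {t \<in> T. v \<in> t}"
  have "\<forall>t\<in>Tv. \<exists>p q. t = {v, p, q} \<and> p \<noteq> v \<and> q \<noteq> v \<and> p \<noteq> q \<and> dependent_triple x v p q"
  proof
    fix t assume t: "t \<in> Tv"
    then have tp: "t \<in> proper_triples S x" "v \<in> t" using T by (auto simp: Tv_def)
    then obtain p where p: "p \<in> t" "p \<noteq> v" unfolding proper_triples_def by blast
    from proper_triples_rename[OF tp p(1) p(2)[symmetric]]
    show "\<exists>p q. t = {v, p, q} \<and> p \<noteq> v \<and> q \<noteq> v \<and> p \<noteq> q \<and> dependent_triple x v p q"
      using p by metis
  qed
  then obtain A B where AB: "\<And>t. t \<in> Tv \<Longrightarrow> t = {v, A t, B t} \<and> A t \<noteq> v \<and> B t \<noteq> v \<and> A t \<noteq> B t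
      \<and> dependent_triple x v (A t) (B t)" by metis
  have eq: "t = u" if "t \<in> Tv" "u \<in> Tv" "p \<in> t" "p \<in> u" "p \<noteq> v" for t u p
    using T(2) that unfolding triple_packing_def Tv_def by blast
  \<comment> \<open>From each triple through \<open>v\<close>, the point \<open>A t\<close> is kept
    and \<open>B t\<close> is dropped, together with \<open>v\<close> itself.\<close>
  define S' where "S' = S - {v} - B ` Tv"
  have injB: "inj_on B Tv"
  proof (rule inj_onI)
    fix t u assume h: "t \<in> Tv" "u \<in> Tv" "B t = B u"
    then have "B t \<in> t" "B t \<in> u" "B t \<noteq> v" using AB by (metis insertCI)+
    then show "t = u" using eq h by blast
  qed
  have sub: "t \<subseteq> S" if "t \<in> Tv" for t using that T proper_triplesD(1) by (fastforce simp: Tv_def)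
  have BS: "B ` Tv \<subseteq> S - {v}" using AB sub by fastforce
  have "card S' = card (S - {v}) - card (B ` Tv)"
    unfolding S'_def using fin BS by (intro card_Diff_subset) (auto intro: finite_subset)
  moreover have "card (B ` Tv) \<le> card (S - {v})" using BS fin by (intro card_mono) auto
  moreover have "card (S - {v}) + 1 = card S" using fin v(1) by (simp add: card_gt_0_iff)
       (metis One_nat_def Suc_pred card_gt_0_iff empty_iff)
  ultimately have card: "card S' + 1 + card Tv = card S" using card_image[OF injB] by linarith
  \<comment> \<open>A dropped \<open>B t\<close> is parallel to \<open>A t\<close> after projection,
    because the relation of the triple loses its \<open>v\<close> term.\<close>
  have rep: "\<exists>r\<in>S'. \<exists>l. l \<noteq> 0 \<and> (\<forall>k. y p k = l * y r k)" if p: "p \<in> S" "p \<noteq> v" for p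
  proof (cases "p \<in> S'")
    case True
    then show ?thesis by (intro bexI[of _ p] exI[of _ 1]) auto
  next
    case False
    then obtain t where t: "t \<in> Tv" "p = B t" using p by (auto simp: S'_def)
    obtain a b c where abc: "a \<noteq> 0" "b \<noteq> 0" "c \<noteq> 0"
      "\<forall>k. a * x v k + b * x (A t) k + c * x (B t) k = 0"
      using AB[OF t(1)] unfolding dependent_triple_def by blast
    \<comment> \<open>If \<open>A t\<close> were dropped on account of a triple \<open>u\<close>,
      then \<open>t\<close> and \<open>u\<close> would share \<open>v\<close> and
      \<open>A t\<close>, hence coincide, although \<open>A t\<close> and \<open>B t\<close>
      differ.\<close>
    have "A t \<notin> B ` Tv"
    proof
      assume "A t \<in> B ` Tv"
      then obtain u where u: "u \<in> Tv" "A t = B u" by blast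
      then have "A t \<in> t" "A t \<in> u" using AB[OF t(1)] AB[OF u(1)] by (metis insertCI)+
      then have "t = u" using eq t u AB by metis
      then show False using u AB[OF t(1)] by simp
    qed
    moreover have "A t \<in> S - {v}" using sub[OF t(1)] AB[OF t(1)] by fastforce
    ultimately have "A t \<in> S'" by (simp add: S'_def)
    moreover have "y p k = - b / c * y (A t) k" for k
      using y_rel[OF abc(4), of k] yv abc t(2) by (simp add: field_simps add_eq_0_iff)
    ultimately show ?thesis using abc by (intro bexI[of _ "A t"] exI[of _ "- b / c"]) auto
  qed
  have "triples_span_bivectors S' y (I - {j})"
    unfolding triples_span_bivectors_def
  proof (intro allI impI)
    fix \<omega> :: "('i \<Rightarrow> real) \<Rightarrow> ('i \<Rightarrow> real) \<Rightarrow> real"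
    assume alt: "alternating \<omega>"
      and van: "\<forall>g\<in>S'. \<forall>h\<in>S'. \<forall>i\<in>S'. dependent_triple y g h i \<longrightarrow> \<omega> (y g) (y h) = 0"
    \<comment> \<open>The form is pulled back along the projection, so that the spanning hypothesis
      for \<open>x\<close> applies to it.\<close>
    define \<omega>' where "\<omega>' = (\<lambda>u w. \<omega> (\<pi> u) (\<pi> w))"
    have alt': "alternating \<omega>'"
      unfolding alternating_def \<omega>'_def lin
      using alternatingD(1)[OF alt] alternatingD(2)[OF alt] by blast
    have "\<omega>' (x g) (x h) = 0"
      if ghi: "g \<in> S" "h \<in> S" "i \<in> S" "dependent_triple x g h i" for g h i
    proof -
      obtain a b c where abc: "a \<noteq> 0" "b \<noteq> 0" "c \<noteq> 0"
        "\<forall>k. a * x g k + b * x h k + c * x i k = 0"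
        using ghi(4) unfolding dependent_triple_def by blast
      note yr = y_rel[OF abc(4)]
      have "\<omega> (y g) (y h) = 0"
      \<comment> \<open>If \<open>v\<close> occurs, the projected relation has at most two terms and
        the form vanishes at once; otherwise all three points are replaced by kept
        representatives.\<close>
      proof (cases "v \<in> {g, h, i}")
        case True
        show ?thesis
        proof (cases "v = g \<or> v = h")
          case True
          then show ?thesis using alternating_zero[OF alt] alternating_zero_right[OF alt] yv by auto
        next
          case False
          then have "v = i" using \<open>v \<in> {g, h, i}\<close> by simp
          then have "\<forall>k. a * y g k + b * y h k + 0 * y h k = 0" using yr yv by simp
          from alternating_relation[OF alt this, of "y h"] abc(1) alternating_self[OF alt]
          show ?thesis by simp
        qed
      next
        case False
        obtain g' lg where g': "g' \<in> S'" "lg \<noteq> 0" "\<And>k. y g k = lg * y g' k" using rep[OF ghi(1)] False by auto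
        obtain h' lh where h': "h' \<in> S'" "lh \<noteq> 0" "\<And>k. y h k = lh * y h' k" using rep[OF ghi(2)] False by auto
        obtain i' li where i': "i' \<in> S'" "li \<noteq> 0" "\<And>k. y i k = li * y i' k" using rep[OF ghi(3)] False by auto
        have "dependent_triple y g' h' i'"
          unfolding dependent_triple_def
          using yr abc g' h' i'
          by (intro exI[of _ "a * lg"] exI[of _ "b * lh"] exI[of _ "c * li"]) (auto simp: mult.assoc)
        then have 0: "\<omega> (y g') (y h') = 0" using van g' h' i' by blast
        have "y g = (\<lambda>k. lg * y g' k)" "y h = (\<lambda>k. lh * y h' k)" using g' h' by auto
        then show ?thesis
          using 0 alternating_scale[OF alt] alternating_scale_right[OF alt] by simp
      qed
      then show ?thesis by (simp add: \<omega>'_def y_def)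
    qed
    then have z: "\<forall>i\<in>I. \<forall>k\<in>I. \<omega>' (unit_vec i) (unit_vec k) = 0"
      using span alt' unfolding triples_span_bivectors_def by blast
    \<comment> \<open>Hence \<open>\<omega>'\<close> and \<open>\<omega>\<close> agree on the unit
      vectors other than that of \<open>j\<close>.\<close>
    have "\<pi> (unit_vec i) = unit_vec i" if "i \<noteq> j" for i
      using that by (auto simp: \<pi>_def unit_vec_def)
    then show "\<forall>i\<in>I - {j}. \<forall>k\<in>I - {j}. \<omega> (unit_vec i) (unit_vec k) = 0"
      using z unfolding \<omega>'_def by (metis DiffE insertCI)
  qed
  moreover have "y s k = 0" if "s \<in> S'" "k \<notin> I - {j}" for s k
    using that j supp v(1) by (auto simp: y_def \<pi>_def S'_def)
  moreover have "S' \<subseteq> S" by (auto simp: S'_def)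
  ultimately show thesis using that[OF j(2)] card by (simp add: Tv_def)
qed

text \<open>Averaging: counting incidences of points with triples gives a total of
  \<open>3 * card T\<close> over \<open>S\<close>. Nonemptiness of the star of \<open>v\<close>
  later ensures that \<open>x v\<close> is nonzero.\<close>

lemma popular_point:
  assumes "finite S" "\<And>t. t \<in> T \<Longrightarrow> t \<subseteq> S \<and> card t = 3" "T \<noteq> {}"
  obtains v where "v \<in> S" "3 * card T \<le> card S * card {t \<in> T. v \<in> t}" "{t \<in> T. v \<in> t} \<noteq> {}"
proof -
  have finT: "finite T" by (rule finite_subset[of _ "Pow S"]) (use assms in auto)
  have "(\<Sum>v\<in>S. card {t \<in> T. v \<in> t}) = (\<Sum>t\<in>T. card {v \<in> S. v \<in> t})"
    by (rule sum_multicount_gen) (use assms(1) finT in auto)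
  also have "\<dots> = (\<Sum>t\<in>T. 3)"
  proof (rule sum.cong)
    fix t assume "t \<in> T"
    moreover from this have "{v \<in> S. v \<in> t} = t" using assms(2) by auto
    ultimately show "card {v \<in> S. v \<in> t} = 3" using assms(2) by simp
  qed simp
  finally have sum: "(\<Sum>v\<in>S. card {t \<in> T. v \<in> t}) = 3 * card T" by simp
  have "\<exists>v\<in>S. 3 * card T \<le> card S * card {t \<in> T. v \<in> t}"
  proof (rule ccontr)
    assume "\<not> ?thesis"
    then have less: "card S * card {t \<in> T. v \<in> t} < 3 * card T" if "v \<in> S" for v using that by force
    have "S \<noteq> {}" using assms by fastforce
    then have "(\<Sum>v\<in>S. card S * card {t \<in> T. v \<in> t}) < (\<Sum>v\<in>S. 3 * card T)"
      using less assms(1) by (intro sum_strict_mono) auto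
    then show False using sum by (simp flip: sum_distrib_left)
  qed
  then obtain v where v: "v \<in> S" "3 * card T \<le> card S * card {t \<in> T. v \<in> t}" by blast
  moreover have "{t \<in> T. v \<in> t} \<noteq> {}"
  proof
    assume e: "{t \<in> T. v \<in> t} = {}"
    have "card T = 0" using v(2)[unfolded e] by simp
    then show False using assms(3) finT by simp
  qed
  ultimately show thesis using that by blast
qed

text \<open>Each quotient step lowers the dimension from \<open>n + 1\<close> to \<open>n\<close>
  and the cube by \<open>3 * n * (n + 1) + 1\<close>. The choice of \<open>v\<close> makes the drop
  in \<open>2 * card S ^ 2\<close> at least \<open>3 * n * (n + 1)\<close>; the summand
  \<open>card I\<close> absorbs the remaining 1.\<close>

theorem triples_span_bivectors_card:
  fixes x :: "'s \<Rightarrow> 'i::linorder \<Rightarrow> real"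
  assumes "finite S" "finite I" "triples_span_bivectors S x I"
    and "\<And>s k. s \<in> S \<Longrightarrow> k \<notin> I \<Longrightarrow> x s k = 0"
  shows "card I ^ 3 \<le> 2 * card S ^ 2 + card I"
  using assms
proof (induction "card I" arbitrary: S x I)
  case 0
  then show ?case by simp
next
  case (Suc n)
  show ?case
  \<comment> \<open>In dimension one no triple need exist, but the inequality is trivial.\<close>
  proof (cases "n = 0")
    case True
    then show ?thesis by (simp flip: Suc.hyps(2))
  next
    case False
    obtain T where T: "T \<subseteq> proper_triples S x" "triple_packing T" "card I * (card I - 1) \<le> 2 * card T"
      using large_triple_packing[OF Suc.prems(1-3)] by metis
    have "0 < card I * (card I - 1)" using False Suc.hyps(2)[symmetric] by simp
    then have "T \<noteq> {}" using T(3) by auto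
    moreover have "t \<subseteq> S \<and> card t = 3" if "t \<in> T" for t
      using T(1) that proper_triplesD(1,2)[of t S x] by auto
    ultimately obtain v where v: "v \<in> S" "3 * card T \<le> card S * card {t \<in> T. v \<in> t}"
      "{t \<in> T. v \<in> t} \<noteq> {}"
      using popular_point[OF Suc.prems(1)] by blast
    from v(3) obtain t where "t \<in> T" "v \<in> t" by blast
    then have xv: "x v \<noteq> (\<lambda>_. 0)" using T(1) proper_triplesD(3)[of t S x v] by auto
    show ?thesis
    proof (rule quotient_triples_span_bivectors[OF Suc.prems(1,3) _ T(1,2) v(1) xv])
      show "x s k = 0" if "s \<in> S" "k \<notin> I" for s k using Suc.prems(4) that .
    next
      fix S' y j
      assume q: "j \<in> I" "S' \<subseteq> S" "card S' + 1 + card {t \<in> T. v \<in> t} = card S"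
        "triples_span_bivectors S' y (I - {j})" "\<And>s k. s \<in> S' \<Longrightarrow> k \<notin> I - {j} \<Longrightarrow> y s k = 0"
      have n: "n = card (I - {j})" using q(1) Suc.hyps(2) Suc.prems(2) by simp
      have "card (I - {j}) ^ 3 \<le> 2 * card S' ^ 2 + card (I - {j})"
        by (rule Suc.hyps(1)[OF n _ _ q(4) q(5)]) (use Suc.prems(1,2) in \<open>auto intro: finite_subset[OF q(2)]\<close>)
      then have IH: "n ^ 3 \<le> 2 * card S' ^ 2 + n" using n by simp
      define d where "d = card {t \<in> T. v \<in> t}"
      have "3 * (Suc n * n) \<le> 2 * (card S * d)" using T(3) v(2) Suc.hyps(2)[symmetric] d_def by simp
      \<comment> \<open>The difference of the squares is \<open>d + 1\<close> times
        \<open>card S + card S'\<close>, hence at least \<open>card S * d\<close>.\<close>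
      moreover have "2 * card S' ^ 2 + 2 * (card S * d) \<le> 2 * card S ^ 2"
      proof -
        have "card S = card S' + 1 + d" using q(3) d_def by simp
        then show ?thesis by (simp add: power2_eq_square algebra_simps)
      qed
      moreover have "Suc n ^ 3 = n ^ 3 + 3 * (Suc n * n) + 1"
        by (simp add: power3_eq_cube algebra_simps)
      ultimately show ?thesis using IH Suc.hyps(2)[symmetric] by simp
    qed
  qed
qed

section \<open>Words modulo a presentation\<close>

lemma pres_eq_in_lists:
  "pres_eq S RW u v \<Longrightarrow> u \<in> lists (S \<times> UNIV) \<and> v \<in> lists (S \<times> UNIV)"
  by (induction rule: pres_eq.induct) auto

lemma pres_eq_append_left:
  "pres_eq S RW u v \<Longrightarrow> w \<in> lists (S \<times> UNIV) \<Longrightarrow> pres_eq S RW (w @ u) (w @ v)"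
proof (induction rule: pres_eq.induct)
  case (pe_refl u) then show ?case by (intro pres_eq.pe_refl) auto
next
  case (pe_sym u v) then show ?case by (blast intro: pres_eq.pe_sym)
next
  case (pe_trans u v z) then show ?case by (blast intro: pres_eq.pe_trans)
next
  case (pe_cancel x y s b)
  then show ?case using pres_eq.pe_cancel[of "w @ x" S y s RW b] by simp
next
  case (pe_rel x y r)
  then show ?case using pres_eq.pe_rel[of "w @ x" S y r RW] by simp
qed

lemma pres_eq_append_right:
  "pres_eq S RW u v \<Longrightarrow> w \<in> lists (S \<times> UNIV) \<Longrightarrow> pres_eq S RW (u @ w) (v @ w)"
proof (induction rule: pres_eq.induct)
  case (pe_refl u) then show ?case by (intro pres_eq.pe_refl) auto
next
  case (pe_sym u v) then show ?case by (blast intro: pres_eq.pe_sym)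
next
  case (pe_trans u v z) then show ?case by (blast intro: pres_eq.pe_trans)
next
  case (pe_cancel x y s b)
  then show ?case using pres_eq.pe_cancel[of x S "y @ w" s RW b] by simp
next
  case (pe_rel x y r)
  then show ?case using pres_eq.pe_rel[of x S "y @ w" r RW] by simp
qed

lemma pres_eq_append:
  assumes "pres_eq S RW u u'" "pres_eq S RW v v'"
  shows "pres_eq S RW (u @ v) (u' @ v')"
  using pres_eq_append_right[OF assms(1), of v] pres_eq_append_left[OF assms(2), of u']
    pres_eq_in_lists[OF assms(1)] pres_eq_in_lists[OF assms(2)] by (blast intro: pe_trans)

lemma pres_class_eq_iff:
  assumes "v \<in> lists (S \<times> UNIV)"
  shows "{z. pres_eq S RW u z} = {z. pres_eq S RW v z} \<longleftrightarrow> pres_eq S RW u v"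
  using pe_refl[OF assms, of RW] by (blast intro: pe_sym pe_trans)

lemma pres_class_mult:
  assumes "u \<in> lists (S \<times> UNIV)" "v \<in> lists (S \<times> UNIV)"
  shows "{z. pres_eq S RW u z} \<otimes>\<^bsub>pres_group S RW\<^esub> {z. pres_eq S RW v z} = {z. pres_eq S RW (u @ v) z}"
  unfolding pres_group_def monoid.simps
  using pe_refl[OF assms(1), of RW] pe_refl[OF assms(2), of RW]
  by (auto intro: pe_trans dest: pres_eq_append)

text \<open>Composing the isomorphism with the class map gives an additive valuation of words,
  faithful up to \<open>pres_eq\<close> and onto; congruence classes are not handled after this
  point.\<close>

lemma iso_Zn_group_word_values:
  assumes "pres_group S RW \<cong> Zn_group n"
  obtains val :: "letter list \<Rightarrow> nat \<Rightarrow> int" where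
    "\<And>u v. u \<in> lists (S \<times> UNIV) \<Longrightarrow> v \<in> lists (S \<times> UNIV) \<Longrightarrow> val (u @ v) = (\<lambda>k. val u k + val v k)"
    "\<And>u v. u \<in> lists (S \<times> UNIV) \<Longrightarrow> v \<in> lists (S \<times> UNIV) \<Longrightarrow> val u = val v \<longleftrightarrow> pres_eq S RW u v"
    "\<And>u k. u \<in> lists (S \<times> UNIV) \<Longrightarrow> k \<ge> n \<Longrightarrow> val u k = 0"
    "\<And>z. \<forall>k\<ge>n. z k = 0 \<Longrightarrow> \<exists>u\<in>lists (S \<times> UNIV). val u = z"
proof -
  obtain \<phi> where \<phi>: "\<phi> \<in> hom (pres_group S RW) (Zn_group n)"
    "\<phi> ` carrier (pres_group S RW) = carrier (Zn_group n)" "inj_on \<phi> (carrier (pres_group S RW))"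
    using assms by (auto simp: is_iso_def iso_iff)
  define cl where "cl = (\<lambda>u. {z. pres_eq S RW u z})"
  have carr: "carrier (pres_group S RW) = cl ` lists (S \<times> UNIV)"
    by (auto simp: pres_group_def cl_def)
  show thesis
  proof (rule that[of "\<lambda>u. \<phi> (cl u)"])
    fix u v :: "letter list" assume uv: "u \<in> lists (S \<times> UNIV)" "v \<in> lists (S \<times> UNIV)"
    have "\<phi> (cl (u @ v)) = \<phi> (cl u \<otimes>\<^bsub>pres_group S RW\<^esub> cl v)"
      using pres_class_mult[OF uv] by (simp add: cl_def)
    also have "\<dots> = \<phi> (cl u) \<otimes>\<^bsub>Zn_group n\<^esub> \<phi> (cl v)"
      using \<phi>(1) uv carr by (intro hom_mult) auto
    finally show "\<phi> (cl (u @ v)) = (\<lambda>k. \<phi> (cl u) k + \<phi> (cl v) k)" by (simp add: Zn_group_def)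
    have "\<phi> (cl u) = \<phi> (cl v) \<longleftrightarrow> cl u = cl v"
      using \<phi>(3) uv carr by (auto simp: inj_on_def)
    then show "\<phi> (cl u) = \<phi> (cl v) \<longleftrightarrow> pres_eq S RW u v"
      using pres_class_eq_iff[OF uv(2)] by (simp add: cl_def)
  next
    fix u :: "letter list" and k assume "u \<in> lists (S \<times> UNIV)" "n \<le> k"
    moreover from this have "\<phi> (cl u) \<in> carrier (Zn_group n)" using \<phi>(2) carr by blast
    ultimately show "\<phi> (cl u) k = 0" by (simp add: Zn_group_def)
  next
    fix z :: "nat \<Rightarrow> int" assume "\<forall>k\<ge>n. z k = 0"
    then have "z \<in> \<phi> ` cl ` lists (S \<times> UNIV)" using \<phi>(2) carr by (simp add: Zn_group_def)
    then show "\<exists>u\<in>lists (S \<times> UNIV). \<phi> (cl u) = z" by blast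
  qed
qed

section \<open>Lifting words to the Heisenberg group\<close>

definition letter_vec :: "(nat \<Rightarrow> 'i \<Rightarrow> real) \<Rightarrow> letter \<Rightarrow> 'i \<Rightarrow> real" where
  "letter_vec x l = (\<lambda>k. (if snd l then 1 else - 1) * x (fst l) k)"

primrec word_vec :: "(nat \<Rightarrow> 'i \<Rightarrow> real) \<Rightarrow> letter list \<Rightarrow> 'i \<Rightarrow> real" where
  "word_vec x [] = (\<lambda>_. 0)"
| "word_vec x (l # w) = (\<lambda>k. letter_vec x l k + word_vec x w k)"

text \<open>Central coordinate of the product of the elements \<open>(x g, 0)\<close> along the word in the Heisenberg
  group with multiplication \<open>(u, s) (v, t) = (u + v, s + t + \<omega> u v)\<close>.\<close>
primrec word_twist ::
  "(('i \<Rightarrow> real) \<Rightarrow> ('i \<Rightarrow> real) \<Rightarrow> real) \<Rightarrow> (nat \<Rightarrow> 'i \<Rightarrow> real) \<Rightarrow> letter list \<Rightarrow> real" where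
  "word_twist \<omega> x [] = 0"
| "word_twist \<omega> x (l # w) = \<omega> (letter_vec x l) (word_vec x w) + word_twist \<omega> x w"

lemma word_vec_append: "word_vec x (u @ v) = (\<lambda>k. word_vec x u k + word_vec x v k)"
  by (induction u) (auto simp: add.assoc)

text \<open>This is the Heisenberg multiplication law: the pair of \<open>word_vec\<close> and
  \<open>word_twist\<close> is multiplicative in the word.\<close>

lemma word_twist_append:
  assumes "alternating \<omega>"
  shows "word_twist \<omega> x (u @ v) = word_twist \<omega> x u + word_twist \<omega> x v + \<omega> (word_vec x u) (word_vec x v)"
  by (induction u)
    (auto simp: word_vec_append alternating_zero[OF assms] alternating_add[OF assms]
      alternating_add_right[OF assms])

lemma word_vec_replicate: "word_vec x (replicate m l) = (\<lambda>k. real m * letter_vec x l k)"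
  by (induction m) (auto simp: algebra_simps)

lemma word_twist_replicate:
  assumes "alternating \<omega>"
  shows "word_twist \<omega> x (replicate m l) = 0"
  by (induction m)
    (auto simp: word_vec_replicate alternating_scale_right[OF assms] alternating_self[OF assms])

lemma word_vec_power_word: "word_vec x (power_word g a) = (\<lambda>k. of_int a * x g k)"
  by (auto simp: power_word_def word_vec_replicate letter_vec_def)

text \<open>Powers of a single lift have no twist, so the twist of a relation is a sum over its
  pairs of syllables. With at most three syllables the vanishing of the vector ties these terms
  together, and a dependent triple arises when all three exponents are nonzero.\<close>

lemma word_twist_three_rel:
  assumes alt: "alternating \<omega>" and r: "three_rel S r" and vec: "word_vec x (rel_word r) = (\<lambda>_. 0)"
    and van: "\<And>g h i. g \<in> S \<Longrightarrow> h \<in> S \<Longrightarrow> i \<in> S \<Longrightarrow> dependent_triple x g h i \<Longrightarrow> \<omega> (x g) (x h) = 0"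
  shows "word_twist \<omega> x (rel_word r) = 0"
proof -
  have tp: "word_twist \<omega> x (power_word g a) = 0" for g a
    unfolding power_word_def by (rule word_twist_replicate[OF alt])
  note twist_simps = rel_word_def word_twist_append[OF alt] tp word_vec_append word_vec_power_word
    alternating_add[OF alt] alternating_add_right[OF alt] alternating_scale[OF alt]
    alternating_scale_right[OF alt] alternating_zero[OF alt] alternating_zero_right[OF alt]
  have "length r \<le> 3" using r by (simp add: three_rel_def)
  then consider "r = []" | p where "r = [p]" | p q where "r = [p, q]" | p q s where "r = [p, q, s]"
    by (force simp: numeral_3_eq_3 le_Suc_eq length_Suc_conv)
  then show ?thesis
  proof cases
    case 1
    then show ?thesis by (simp add: rel_word_def)
  next
    case (2 p)
    then show ?thesis by (cases p) (simp add: twist_simps)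
  next
    case (3 p q)
    obtain g a h b where pq: "p = (g, a)" "q = (h, b)" by fastforce
    \<comment> \<open>A term with coefficient 0 pads the relation to three terms.\<close>
    have "\<forall>k. of_int a * x g k + of_int b * x h k + 0 * x h k = 0"
      using fun_cong[OF vec] 3 pq by (simp add: twist_simps)
    from alternating_relation[OF alt this, of "x h"]
    have "of_int a * \<omega> (x g) (x h) = 0" by (simp add: alternating_self[OF alt])
    then show ?thesis using 3 pq by (auto simp: twist_simps)
  next
    case (4 p q s)
    obtain g a h b i c where pqs: "p = (g, a)" "q = (h, b)" "s = (i, c)"
      by (metis surj_pair)
    have S: "g \<in> S" "h \<in> S" "i \<in> S" using r 4 pqs by (auto simp: three_rel_def)
    have rel: "\<forall>k. of_int a * x g k + of_int b * x h k + of_int c * x i k = 0"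
      using fun_cong[OF vec] 4 pqs by (simp add: twist_simps add.assoc)
    note R = alternating_relation[OF alt rel]
    \<comment> \<open>If some exponent is zero, pairing the relation with \<open>x i\<close> already
      gives this; otherwise the triple is dependent.\<close>
    have hi: "of_int b * of_int c * \<omega> (x h) (x i) = 0"
    proof (cases "a = 0 \<or> b = 0 \<or> c = 0")
      case True
      then show ?thesis using R[of "x i"] alternating_self[OF alt, of "x i"] by auto
    next
      case False
      then have "dependent_triple x g h i"
        unfolding dependent_triple_def using rel
        by (intro exI[of _ "of_int a"] exI[of _ "of_int b"] exI[of _ "of_int c"]) auto
      from van[OF S(2,3,1) dependent_triple_rotate[OF this]] have "\<omega> (x h) (x i) = 0" .
      then show ?thesis by simp
    qed
    \<comment> \<open>Pairing the relation with \<open>x h\<close> and \<open>x i\<close> expresses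
      the other two terms through \<open>\<omega> (x h) (x i)\<close>.\<close>
    have e: "of_int a * \<omega> (x g) (x h) = of_int c * \<omega> (x h) (x i)"
      "of_int a * \<omega> (x g) (x i) = - (of_int b * \<omega> (x h) (x i))"
      using R[of "x h"] R[of "x i"] unfolding alternating_self[OF alt] alternatingD(2)[OF alt, of "x i" "x h"]
      by linarith+
    have "of_int b * (of_int a * \<omega> (x g) (x h)) = 0" "of_int c * (of_int a * \<omega> (x g) (x i)) = 0"
      unfolding e using hi by auto
    then show ?thesis using 4 pqs hi by (auto simp: twist_simps)
  qed
qed

section \<open>From presentations to spanning triples, and the final bound\<close>

lemma three_presentation_triples_span_bivectors:
  assumes rels: "\<forall>r\<in>R. three_rel S r" and iso: "pres_group S (rel_word ` R) \<cong> Zn_group n"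
  obtains x where "triples_span_bivectors S x {..<n}"
    "\<And>s k. s \<in> S \<Longrightarrow> k \<notin> {..<n} \<Longrightarrow> x s k = (0::real)"
proof -
  let ?L = "lists (S \<times> (UNIV :: bool set))"
  obtain val :: "letter list \<Rightarrow> nat \<Rightarrow> int" where
    val_append: "\<And>u v. u \<in> ?L \<Longrightarrow> v \<in> ?L \<Longrightarrow> val (u @ v) = (\<lambda>k. val u k + val v k)"
    and val_eq: "\<And>u v. u \<in> ?L \<Longrightarrow> v \<in> ?L \<Longrightarrow> val u = val v \<longleftrightarrow> pres_eq S (rel_word ` R) u v"
    and val_supp: "\<And>u k. u \<in> ?L \<Longrightarrow> k \<ge> n \<Longrightarrow> val u k = 0"
    and val_surj: "\<And>z. \<forall>k\<ge>n. z k = 0 \<Longrightarrow> \<exists>u\<in>?L. val u = z"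
    by (fact iso_Zn_group_word_values[OF iso])
  define x where "x = (\<lambda>g k. real_of_int (val [(g, True)] k))"
  have val_Nil: "val [] = (\<lambda>_. 0)" using val_append[of "[]" "[]"] by (auto simp: fun_eq_iff)
  have letter: "real_of_int (val [(g, b)] k) = letter_vec x (g, b) k" if "g \<in> S" for g b k
  proof (cases b)
    case False
    have "pres_eq S (rel_word ` R) ([] @ [(g, True), (g, \<not> True)] @ []) ([] @ [])"
      by (rule pe_cancel) (use that in auto)
    then have "val [(g, True), (g, False)] = val []"
      using val_eq[of "[(g, True), (g, False)]" "[]"] that by simp
    then have "val [(g, True)] k + val [(g, False)] k = 0"
      using val_append[of "[(g, True)]" "[(g, False)]"] val_Nil that by (auto simp: fun_eq_iff)
    then show ?thesis using False by (simp add: letter_vec_def x_def flip: of_int_add)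
  qed (simp add: letter_vec_def x_def)
  have word: "(\<lambda>k. real_of_int (val w k)) = word_vec x w" if "w \<in> ?L" for w
    using that
  proof (induction w)
    case Nil
    then show ?case by (simp add: val_Nil)
  next
    case (Cons l w)
    then have "val (l # w) = (\<lambda>k. val [l] k + val w k)" using val_append[of "[l]" w] by auto
    then show ?case using Cons letter[of "fst l" "snd l"] by (auto simp: fun_eq_iff)
  qed
  have rel_vec: "word_vec x r = (\<lambda>_. 0)" if "r \<in> rel_word ` R" "r \<in> ?L" for r
  proof -
    have "pres_eq S (rel_word ` R) ([] @ r @ []) ([] @ [])" by (rule pe_rel) (use that in auto)
    then have "val r = val []" using val_eq[of r "[]"] that by simp
    then show ?thesis using word[OF that(2)] val_Nil by simp
  qed
  have "triples_span_bivectors S x {..<n}"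
    unfolding triples_span_bivectors_def
  proof (intro allI impI)
    fix \<omega> :: "(nat \<Rightarrow> real) \<Rightarrow> (nat \<Rightarrow> real) \<Rightarrow> real"
    assume alt: "alternating \<omega>"
      and van: "\<forall>g\<in>S. \<forall>h\<in>S. \<forall>i\<in>S. dependent_triple x g h i \<longrightarrow> \<omega> (x g) (x h) = 0"
    note zeros = alternating_zero[OF alt] alternating_zero_right[OF alt]
    \<comment> \<open>Both coordinates are invariant under \<open>pres_eq\<close>, so the lifts
      define a homomorphism from the presented group to the Heisenberg group.\<close>
    have inv: "word_vec x u = word_vec x v \<and> word_twist \<omega> x u = word_twist \<omega> x v"
      if "pres_eq S (rel_word ` R) u v" for u v
      using that
    proof (induction rule: pres_eq.induct)
      case (pe_cancel y z s b)
      have "word_vec x [(s, b), (s, \<not> b)] = (\<lambda>_. 0)" by (auto simp: letter_vec_def)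
      moreover have "word_twist \<omega> x [(s, b), (s, \<not> b)] = 0"
        unfolding word_twist.simps word_vec.simps letter_vec_def
        by (simp add: zeros alternating_scale[OF alt] alternating_scale_right[OF alt]
            alternating_self[OF alt] del: mult_minus1)
      ultimately show ?case
        unfolding word_vec_append[of x y] word_vec_append[of x "[(s, b), (s, \<not> b)]"]
          word_twist_append[OF alt, of x y] word_twist_append[OF alt, of x "[(s, b), (s, \<not> b)]"]
        by (simp add: zeros del: word_vec.simps word_twist.simps)
    next
      case (pe_rel y z r)
      have "word_vec x r = (\<lambda>_. 0)" by (rule rel_vec[OF pe_rel(3,4)])
      moreover from this have "word_twist \<omega> x r = 0"
        using pe_rel(3) rels van word_twist_three_rel[OF alt] by blast
      ultimately show ?case
        by (simp add: word_vec_append word_twist_append[OF alt] zeros)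
    qed simp_all
    \<comment> \<open>The words \<open>gh\<close> and \<open>hg\<close> agree in the abelian group,
      hence have equal twist; antisymmetry then forces the value 0.\<close>
    have gens: "\<omega> (x g) (x h) = 0" if gh: "g \<in> S" "h \<in> S" for g h
    proof -
      let ?u = "[(g, True), (h, True)]" and ?v = "[(h, True), (g, True)]"
      have L: "[(g, True)] \<in> ?L" "[(h, True)] \<in> ?L" "?u \<in> ?L" "?v \<in> ?L" using gh by auto
      have "val ?u = val ?v"
        using val_append[OF L(1,2)] val_append[OF L(2,1)] by (simp add: add.commute)
      then have "word_twist \<omega> x ?u = word_twist \<omega> x ?v" using val_eq[OF L(3,4)] inv by blast
      then have "\<omega> (x g) (x h) = \<omega> (x h) (x g)" by (simp add: letter_vec_def zeros)
      then show ?thesis using alternatingD(2)[OF alt, of "x g" "x h"] by simp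
    qed
    have gen_word: "\<omega> (x g) (word_vec x w) = 0" if "g \<in> S" "w \<in> ?L" for g w
      using that(2)
      by (induction w) (auto simp: zeros alternating_add_right[OF alt] letter_vec_def
          alternating_scale_right[OF alt, of _ "- 1", simplified] gens that(1))
    have words: "\<omega> (word_vec x u) (word_vec x w) = 0" if "u \<in> ?L" "w \<in> ?L" for u w
      using that(1)
      by (induction u) (auto simp: zeros alternating_add[OF alt] letter_vec_def
          alternating_scale[OF alt, of "- 1", simplified] gen_word that(2))
    have unit: "\<exists>w\<in>?L. word_vec x w = unit_vec i" if "i < n" for i
    proof -
      have "\<exists>w\<in>?L. val w = (\<lambda>k. if k = i then 1 else 0)"
        by (rule val_surj) (use that in auto)
      then obtain w where w: "w \<in> ?L" "val w = (\<lambda>k. if k = i then 1 else 0)" by blast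
      have "word_vec x w = unit_vec i"
        unfolding word[OF w(1), symmetric] w(2) unit_vec_def by auto
      then show ?thesis using w(1) by blast
    qed
    show "\<forall>i\<in>{..<n}. \<forall>j\<in>{..<n}. \<omega> (unit_vec i) (unit_vec j) = 0"
      using unit words by (metis lessThan_iff)
  qed
  moreover have "x s k = 0" if "s \<in> S" "k \<notin> {..<n}" for s k
    using that val_supp[of "[(s, True)]" k] by (simp add: x_def)
  ultimately show thesis using that by blast
qed

text \<open>Over the empty alphabet there is only the empty word, hence one value, while the target
  has at least two elements. This settles the case \<open>n = 1\<close> of the final
  estimate.\<close>

lemma pres_group_Zn_generators_nonempty:
  assumes "pres_group S RW \<cong> Zn_group n" "n \<ge> 1"
  shows "S \<noteq> {}"
proof
  assume S: "S = {}"
  show False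
  proof (rule iso_Zn_group_word_values[OF assms(1)])
    fix val :: "letter list \<Rightarrow> nat \<Rightarrow> int"
    assume val: "\<And>z. \<forall>k\<ge>n. z k = 0 \<Longrightarrow> \<exists>u\<in>lists (S \<times> UNIV). val u = z"
    have "val [] = z" if "\<forall>k\<ge>n. z k = 0" for z using val[OF that] S by auto
    from this[of "\<lambda>_. 0"] this[of "\<lambda>k. if k = 0 then 1 else 0"] assms(2)
    have "(\<lambda>_. 0 :: int) = (\<lambda>k :: nat. if k = 0 then 1 else 0)" by auto
    from fun_cong[OF this, of 0] show False by simp
  qed
qed

theorem mainTheorem17:
  shows "\<exists>c::real > 0. \<forall>(n::nat) (S::nat set) (R::expword set).
           n \<ge> 1 \<and> finite S \<and> finite R \<and> (\<forall>r\<in>R. three_rel S r) \<and>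
           pres_group S (rel_word ` R) \<cong> Zn_group n
           \<longrightarrow> real (card S) \<ge> c * real n powr (3/2)"
proof (intro exI[of _ "1/2"] conjI allI impI)
  fix n :: nat and S :: "nat set" and R :: "expword set"
  assume asm: "n \<ge> 1 \<and> finite S \<and> finite R \<and> (\<forall>r\<in>R. three_rel S r) \<and>
    pres_group S (rel_word ` R) \<cong> Zn_group n"
  then have rels: "\<forall>r\<in>R. three_rel S r" and iso: "pres_group S (rel_word ` R) \<cong> Zn_group n" by auto
  obtain x where x: "triples_span_bivectors S x {..<n}"
    "\<And>s k. s \<in> S \<Longrightarrow> k \<notin> {..<n} \<Longrightarrow> x s k = 0"
    by (fact three_presentation_triples_span_bivectors[OF rels iso])
  have "n ^ 3 \<le> 2 * card S ^ 2 + n"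
    using triples_span_bivectors_card[OF _ _ x(1)] x(2) asm by simp
  then have "real (n ^ 3) \<le> real (2 * card S ^ 2 + n)" by (rule of_nat_mono)
  then have bound: "real n ^ 3 \<le> 2 * real (card S) ^ 2 + real n" by simp
  have "S \<noteq> {}" using pres_group_Zn_generators_nonempty asm by blast
  then have "card S \<ge> 1" using asm by (simp add: Suc_le_eq card_gt_0_iff)
  then have S1: "real (card S) ^ 2 \<ge> 1" by simp
  \<comment> \<open>The constant 4 yields \<open>1/2\<close> after taking roots. For
    \<open>n\<close> at least 2 the linear term is at most a quarter of the cube and is absorbed;
    for \<open>n = 1\<close> the bound is empty and a nonempty \<open>S\<close> is used
    instead.\<close>
  have sq: "real n ^ 3 \<le> 4 * real (card S) ^ 2"
  proof (cases "n = 1")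
    case True
    then show ?thesis using S1 by simp
  next
    case False
    then have "2 \<le> real n" using asm by simp
    then have "2 ^ 2 \<le> real n ^ 2" by (intro power_mono) auto
    then have "4 * real n \<le> real n ^ 2 * real n" by (intro mult_right_mono) auto
    then have "4 * real n \<le> real n ^ 3" by (simp add: power2_eq_square power3_eq_cube)
    then show ?thesis using bound by linarith
  qed
  have "(real n powr (3/2)) ^ 2 = real n powr 3"
    by (simp add: power2_eq_square flip: powr_add)
  also have "\<dots> = real n ^ 3" using asm by (simp add: powr_numeral)
  also have "\<dots> \<le> (2 * real (card S)) ^ 2" using sq by (simp add: power_mult_distrib)
  finally have "real n powr (3/2) \<le> 2 * real (card S)" by (rule power2_le_imp_le) simp
  then show "real (card S) \<ge> 1/2 * real n powr (3/2)" by simp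
qed simp

end
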